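(* Let $\varphi_D^t$ be a homogeneous Poisson point process on $\mathbb{R}$ with intensity $\lambda_D>0$, and let $n\ge 1$ be an integer. Let $x_1<x_2<\cdots<x_n$ be the distances from the origin to the nearest, second nearest, ..., $n$-th nearest points of $\varphi_D^t$. Then the random vector $(x_1,\dots,x_n)$ has the joint probability density function $$f(x_1,x_2,\dots,x_n)=(2\lambda_D)^n e^{-2\lambda_D x_n}\qquad\text{for } 0<x_1<x_2<\cdots<x_n<\infty,$$ and density $0$ elsewhere.
   Context: The points of $\varphi_D^t$ model the locations of downlink base stations (DBSs) along a road, which is identified with the real line (after a random displacement that absorbs shadow fading, so that $\lambda_D$ is the intensity of the displaced process). The typical vehicle is located at the origin and is served by the $n$ nearest DBSs, and $x_i$ is the distance (absolute value of the position) of the $i$-th nearest DBS. Almost surely these distances are distinct and positive. *)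

theory Defs
  imports "HOL-Probability.Probability"
begin

text \<open>
  A point configuration is a set of reals, so realisations are simple (no multiple points);
  this loses nothing for a Poisson process with diffuse intensity.  By local finiteness
  \<^term>\<open>card\<close> is the genuine number of points in every bounded set.  In \<open>count_eq\<close>, a Lebesgue-null
  \<^term>\<open>B\<close> is covered by \<open>0 ^ 0 = 1\<close>.
\<close>

locale homogeneous_poisson_process = prob_space M
  for M :: "'w measure" +
  fixes rate :: real
    and \<Phi> :: "'w \<Rightarrow> real set"
  assumes locally_finite:
      "\<And>\<omega> B. \<omega> \<in> space M \<Longrightarrow> bounded B \<Longrightarrow> finite (\<Phi> \<omega> \<inter> B)"
    and count_measurable:
      "\<And>B. B \<in> sets borel \<Longrightarrow> bounded B \<Longrightarrow>
         (\<lambda>\<omega>. card (\<Phi> \<omega> \<inter> B)) \<in> measurable M (count_space UNIV)"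
    and count_eq:
      "\<And>B k. B \<in> sets borel \<Longrightarrow> bounded B \<Longrightarrow>
         prob {\<omega> \<in> space M. card (\<Phi> \<omega> \<inter> B) = k} =
           (rate * measure lborel B) ^ k / fact k * exp (- (rate * measure lborel B))"
    and count_indep:
      "\<And>(J :: nat set) B. finite J \<Longrightarrow> disjoint_family_on B J \<Longrightarrow>
         (\<And>j. j \<in> J \<Longrightarrow> B j \<in> sets borel \<and> bounded (B j)) \<Longrightarrow>
         indep_vars (\<lambda>_. count_space UNIV) (\<lambda>j \<omega>. card (\<Phi> \<omega> \<inter> B j)) J"

text \<open>
  Distance from the origin to the \<open>i\<close>-th nearest point of \<open>S\<close> (\<open>i \<ge> 1\<close>), points at equal distance
  being counted separately.  The value is junk if \<open>S\<close> has fewer than \<open>i\<close> points.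
\<close>

definition nearest_dist :: "real set \<Rightarrow> nat \<Rightarrow> real" where
  "nearest_dist S i = Inf {r. 0 \<le> r \<and> i \<le> card (S \<inter> cball 0 r)}"

lemma nearest_dist_eqI:
  fixes p :: "nat \<Rightarrow> real"
  assumes fin: "\<And>r. finite (S \<inter> cball 0 r)"
    and "1 \<le> i" and inj: "inj_on p {1..i}" and sub: "p ` {1..i} \<subseteq> S"
    and mono: "mono_on {1..i} (\<lambda>j. \<bar>p j\<bar>)"
    and rest: "\<And>q. q \<in> S - p ` {1..i} \<Longrightarrow> \<bar>p i\<bar> \<le> \<bar>q\<bar>"
  shows "nearest_dist S i = \<bar>p i\<bar>"
  unfolding nearest_dist_def
proof (rule cInf_eq_minimum)
  have "p ` {1..i} \<subseteq> S \<inter> cball 0 \<bar>p i\<bar>"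
    using sub mono by (auto simp: mono_on_def)
  from card_mono[OF fin this] show "\<bar>p i\<bar> \<in> {r. 0 \<le> r \<and> i \<le> card (S \<inter> cball 0 r)}"
    using card_image[OF inj] by simp
next
  fix r assume "r \<in> {r. 0 \<le> r \<and> i \<le> card (S \<inter> cball 0 r)}"
  then have r: "i \<le> card (S \<inter> cball 0 r)" by simp
  show "\<bar>p i\<bar> \<le> r"
  proof (rule ccontr)
    assume "\<not> \<bar>p i\<bar> \<le> r"
    then have "S \<inter> cball 0 r \<subseteq> p ` {1..i} - {p i}"
      using rest by force
    then have "card (S \<inter> cball 0 r) \<le> card (p ` {1..i} - {p i})"
      by (intro card_mono) auto
    also have "\<dots> < card (p ` {1..i})"
      using \<open>1 \<le> i\<close> by (intro card_Diff1_less) auto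
    also have "\<dots> = i" using card_image[OF inj] by simp
    finally show False using r by simp
  qed
qed

end

theory Submission
  imports Defs
begin

text \<open>
  Let \<open>N r\<close> be the number of points in the ball of radius \<open>r\<close>.  Almost surely the \<open>i\<close>-th distance
  lies in \<open>(a i, b i]\<close> iff \<open>N (a i) < i \<le> N (b i)\<close>.  For interlaced intervals,
  \<open>0 \<le> a 1 \<le> b 1 \<le> a 2 \<le> \<dots> \<le> b n\<close>, these conditions prescribe the numbers of points in the
  disjoint annuli cut out by the endpoints, and independence gives the probability of the box as a
  product, which is also its mass under the claimed density.  Such boxes form an
  intersection-stable generator of the Borel sets of the open simplex \<open>0 < x 1 < \<dots> < x n\<close>, so the
  two measures agree there.  The density has total mass 1, so the law of the distances
  has no mass outside the simplex; in particular ties need no separate argument.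
\<close>

section \<open>Ordered boxes in the simplex\<close>

text \<open>Adjacent comparisons are finitely many and each involves two coordinates only, which
  suits both measurability arguments and splitting off the last coordinate.\<close>

lemma strict_mono_on_nat_atLeastAtMost_iff:
  fixes x :: "nat \<Rightarrow> 'a::order"
  shows "strict_mono_on {m..n} x \<longleftrightarrow> (\<forall>j\<in>{m..<n}. x j < x (Suc j))"
proof (intro iffI ballI)
  fix j assume "strict_mono_on {m..n} x" "j \<in> {m..<n}"
  then show "x j < x (Suc j)" by (auto simp: strict_mono_on_def)
next
  assume *: "\<forall>j\<in>{m..<n}. x j < x (Suc j)"
  have "x r < x s" if "m \<le> r" "r < s" "s \<le> n" for r s
    using that(2,3)
  proof (induction s)
    case (Suc s)
    then have "x s < x (Suc s)" using * that(1) by auto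
    moreover have "r = s \<or> x r < x s" using Suc by (cases "r = s") auto
    ultimately show ?case by (auto intro: less_trans)
  qed simp
  then show "strict_mono_on {m..n} x" by (auto simp: strict_mono_on_def)
qed

text \<open>Extensionality places the simplex inside the space of the product measure over
  \<open>{1..n}\<close>.\<close>

definition ordered_simplex :: "nat \<Rightarrow> (nat \<Rightarrow> real) set" where
  "ordered_simplex n = {x \<in> extensional {1..n}. 0 < x 1 \<and> strict_mono_on {1..n} x}"

definition half_open_box :: "nat \<Rightarrow> (nat \<Rightarrow> real) \<Rightarrow> (nat \<Rightarrow> real) \<Rightarrow> (nat \<Rightarrow> real) set" where
  "half_open_box n a b = (\<Pi>\<^sub>E i\<in>{1..n}. {a i<..b i})"

text \<open>Weak inequalities suffice because the intervals are half-open: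
  \<open>x i \<le> b i \<le> a (Suc i) < x (Suc i)\<close> is strict at the last step, and likewise
  \<open>0 \<le> a 1 < x 1\<close>. Degenerate intervals are allowed, so that the empty set is also
  a box.\<close>

definition ordered_bounds :: "nat \<Rightarrow> (nat \<Rightarrow> real) \<Rightarrow> (nat \<Rightarrow> real) \<Rightarrow> bool" where
  "ordered_bounds n a b \<longleftrightarrow> 0 \<le> a 1 \<and> (\<forall>i\<in>{1..n}. a i \<le> b i) \<and> (\<forall>i\<in>{1..<n}. b i \<le> a (Suc i))"

definition ordered_boxes :: "nat \<Rightarrow> (nat \<Rightarrow> real) set set" where
  "ordered_boxes n = {half_open_box n a b | a b. ordered_bounds n a b}"

lemma half_open_box_subset_simplex:
  assumes "1 \<le> n" "ordered_bounds n a b"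
  shows "half_open_box n a b \<subseteq> ordered_simplex n"
proof
  fix x assume x: "x \<in> half_open_box n a b"
  then have xi: "a i < x i" "x i \<le> b i" if "i \<in> {1..n}" for i
    using that by (auto simp: half_open_box_def PiE_iff)
  have "x j < x (Suc j)" if "j \<in> {1..<n}" for j
    using xi[of j] xi[of "Suc j"] that assms(2) unfolding ordered_bounds_def by fastforce
  moreover have "0 < x 1" using xi[of 1] assms unfolding ordered_bounds_def by auto
  ultimately show "x \<in> ordered_simplex n"
    using x by (auto simp: ordered_simplex_def half_open_box_def PiE_iff
      strict_mono_on_nat_atLeastAtMost_iff)
qed

lemma half_open_box_Int:
  "half_open_box n a b \<inter> half_open_box n a' b' =
    half_open_box n (\<lambda>i. max (a i) (a' i)) (\<lambda>i. min (b i) (b' i))"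
  by (auto simp: half_open_box_def PiE_iff)

text \<open>Interlacing survives taking maxima of lower and minima of upper bounds. Only
  \<open>a i \<le> b i\<close> can fail, and then the intersection is empty and is represented by a
  degenerate box.\<close>

lemma Int_stable_ordered_boxes:
  assumes "1 \<le> n"
  shows "Int_stable (ordered_boxes n)"
proof (rule Int_stableI)
  fix A B assume "A \<in> ordered_boxes n" "B \<in> ordered_boxes n"
  then obtain a b a' b' where ab: "ordered_bounds n a b" "ordered_bounds n a' b'"
    and AB: "A = half_open_box n a b" "B = half_open_box n a' b'"
    by (auto simp: ordered_boxes_def)
  let ?a = "\<lambda>i. max (a i) (a' i)" and ?b = "\<lambda>i. min (b i) (b' i)"
  show "A \<inter> B \<in> ordered_boxes n"
  proof (cases "\<forall>i\<in>{1..n}. ?a i \<le> ?b i")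
    case True
    have "?b i \<le> ?a (Suc i)" if "i \<in> {1..<n}" for i
    proof -
      have "b i \<le> a (Suc i)" using ab(1) that by (auto simp: ordered_bounds_def)
      then show ?thesis by linarith
    qed
    then have "ordered_bounds n ?a ?b"
      using True ab unfolding ordered_bounds_def by (auto simp: le_max_iff_disj)
    then show ?thesis
      unfolding AB half_open_box_Int ordered_boxes_def by blast
  next
    case False
    then obtain i where i: "i \<in> {1..n}" "{?a i<..?b i} = {}" by force
    have "half_open_box n ?a ?b = {}"
      unfolding half_open_box_def PiE_eq_empty_iff using i by (rule bexI[rotated])
    then have "A \<inter> B = {}" by (simp add: AB half_open_box_Int)
    \<comment> \<open>A product is empty only if some factor is; \<open>1 \<le> n\<close> supplies
      the factor with index 1.\<close>
    also have "{} = half_open_box n (\<lambda>_. 0) (\<lambda>_. 0)"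
      using assms unfolding half_open_box_def
      by (intro PiE_eq_empty_iff[THEN iffD2, symmetric] bexI[of _ 1]) auto
    finally have *: "A \<inter> B = half_open_box n (\<lambda>_. 0) (\<lambda>_. 0)" .
    have "ordered_bounds n (\<lambda>_. 0) (\<lambda>_. 0)" by (simp add: ordered_bounds_def)
    with * show ?thesis unfolding ordered_boxes_def by blast
  qed
qed

text \<open>Endpoint functions are taken extensional: arbitrary values outside \<open>{1..n}\<close>
  would not change the box but would make the index set uncountable.\<close>

definition rational_ordered_boxes :: "nat \<Rightarrow> (nat \<Rightarrow> real) set set" where
  "rational_ordered_boxes n =
    (\<lambda>(a, b). half_open_box n a b) `
      {(a, b) \<in> (\<Pi>\<^sub>E i\<in>{1..n}. \<rat>) \<times> (\<Pi>\<^sub>E i\<in>{1..n}. \<rat>). ordered_bounds n a b}"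

lemma countable_rational_ordered_boxes: "countable (rational_ordered_boxes n)"
proof -
  have "countable (\<Pi>\<^sub>E i\<in>{1..n}. \<rat> :: real set)"
    by (intro countable_PiE countable_rat) simp
  from countable_SIGMA[OF this this] show ?thesis
    unfolding rational_ordered_boxes_def by (auto intro!: countable_image elim: countable_subset[rotated])
qed

lemma rational_ordered_boxes_subset: "rational_ordered_boxes n \<subseteq> ordered_boxes n"
  by (auto simp: rational_ordered_boxes_def ordered_boxes_def)

text \<open>The bound by \<open>\<delta>\<close> allows a box around \<open>x\<close> to be kept
  inside a half-space that contains \<open>x\<close>; without it the boxes would only be known to
  cover the simplex.\<close>

lemma ex_rational_ordered_box:
  assumes n: "1 \<le> n" and x: "x \<in> ordered_simplex n" and "0 < \<delta>"
  obtains a b where "half_open_box n a b \<in> rational_ordered_boxes n" "x \<in> half_open_box n a b"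
    "\<And>i. i \<in> {1..n} \<Longrightarrow> b i < x i + \<delta>"
proof -
  \<comment> \<open>Each element of \<open>D\<close> guards one requirement on the tolerance
    \<open>e\<close>: \<open>\<delta>\<close> bounds \<open>b i\<close>, \<open>x 1\<close> keeps
    \<open>a 1\<close> nonnegative, and half of each gap gives
    \<open>b i < x i + e \<le> x (Suc i) - e < a (Suc i)\<close>.\<close>
  define D where "D = {\<delta>, x 1} \<union> (\<lambda>j. (x (Suc j) - x j) / 2) ` {1..<n}"
  define e where "e = Min D"
  have D: "finite D" "D \<noteq> {}" by (auto simp: D_def)
  have "\<forall>d\<in>D. 0 < d"
    using x \<open>0 < \<delta>\<close> by (auto simp: D_def ordered_simplex_def strict_mono_on_nat_atLeastAtMost_iff)
  then have e: "0 < e" using D by (simp add: e_def)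
  have le: "e \<le> d" if "d \<in> D" for d using that D by (simp add: e_def)
  have "\<forall>i. \<exists>q\<in>\<rat>. x i - e < q \<and> q < x i" using e by (intro allI Rats_dense_in_real) auto
  then obtain a where a: "\<And>i. a i \<in> \<rat>" "\<And>i. x i - e < a i" "\<And>i. a i < x i" by metis
  have "\<forall>i. \<exists>q\<in>\<rat>. x i < q \<and> q < x i + e" using e by (intro allI Rats_dense_in_real) auto
  then obtain b where b: "\<And>i. b i \<in> \<rat>" "\<And>i. x i < b i" "\<And>i. b i < x i + e" by metis
  let ?a = "restrict a {1..n}" and ?b = "restrict b {1..n}"
  have "b i \<le> a (Suc i)" if "i \<in> {1..<n}" for i
    using le[of "(x (Suc i) - x i) / 2"] that a(2)[of "Suc i"] b(3)[of i] by (auto simp: D_def)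
  moreover have "0 \<le> a 1" using le[of "x 1"] a(2)[of 1] by (auto simp: D_def)
  moreover have "a i \<le> b i" for i using a(3)[of i] b(2)[of i] by simp
  ultimately have "ordered_bounds n ?a ?b" using n by (auto simp: ordered_bounds_def)
  then have "half_open_box n ?a ?b \<in> rational_ordered_boxes n"
    using a(1) b(1) unfolding rational_ordered_boxes_def by fastforce
  moreover have "x \<in> half_open_box n ?a ?b"
    using x a(3) b(2) by (auto simp: half_open_box_def ordered_simplex_def PiE_iff less_imp_le)
  moreover have "?b i < x i + \<delta>" if "i \<in> {1..n}" for i
    using that b(3)[of i] le[of \<delta>] by (auto simp: D_def)
  ultimately show ?thesis by (rule that)
qed

lemma ordered_simplex_eq_Union:
  assumes "1 \<le> n"
  shows "ordered_simplex n = \<Union>(rational_ordered_boxes n)"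
proof
  show "ordered_simplex n \<subseteq> \<Union>(rational_ordered_boxes n)"
    using ex_rational_ordered_box[OF assms _ zero_less_one] by blast
  show "\<Union>(rational_ordered_boxes n) \<subseteq> ordered_simplex n"
    using half_open_box_subset_simplex[OF assms] by (auto simp: rational_ordered_boxes_def)
qed

text \<open>It is enough that every coordinate is measurable for the sigma-algebra generated by the
  boxes: the identity is then measurable into the product space, and the preimage of
  \<open>X\<close> is its trace on the simplex.\<close>

lemma sigma_sets_ordered_boxes:
  assumes n: "1 \<le> n" and X: "X \<in> sets (\<Pi>\<^sub>M i\<in>{1..n}. (lborel :: real measure))"
  shows "X \<inter> ordered_simplex n \<in> sigma_sets (ordered_simplex n) (ordered_boxes n)"
proof -
  let ?\<Omega> = "ordered_simplex n" and ?S = "sigma (ordered_simplex n) (ordered_boxes n)"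
  have Pow: "ordered_boxes n \<subseteq> Pow ?\<Omega>"
    using half_open_box_subset_simplex[OF n] by (auto simp: ordered_boxes_def)
  have "(\<lambda>x. x i) \<in> borel_measurable ?S" if i: "i \<in> {1..n}" for i
  proof (rule borel_measurableI_less)
    fix c :: real
    let ?W = "{x \<in> ?\<Omega>. x i < c}" and ?C = "{B \<in> rational_ordered_boxes n. \<forall>x\<in>B. x i < c}"
    \<comment> \<open>A half-space within the simplex is the union of the countably many rational
      boxes it contains; a point \<open>x\<close> of it is reached with tolerance
      \<open>c - x i\<close>.\<close>
    have "?W = \<Union>?C"
    proof
      show "?W \<subseteq> \<Union>?C"
      proof
        fix x assume "x \<in> ?W"
        then have x: "x \<in> ?\<Omega>" and c: "0 < c - x i" by auto
        from ex_rational_ordered_box[OF n x c] obtain a b where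
          *: "half_open_box n a b \<in> rational_ordered_boxes n" "x \<in> half_open_box n a b"
            "b i < x i + (c - x i)" using i by metis
        have "y i < c" if "y \<in> half_open_box n a b" for y
        proof -
          have "y i \<le> b i" using that i by (simp add: half_open_box_def PiE_iff)
          with *(3) show ?thesis by simp
        qed
        with * show "x \<in> \<Union>?C" by blast
      qed
      show "\<Union>?C \<subseteq> ?W" using ordered_simplex_eq_Union[OF n] by auto
    qed
    moreover have "\<Union>?C \<in> sets ?S"
      using rational_ordered_boxes_subset[of n] Pow
      by (intro sets.countable_Union)
        (auto intro: countable_subset[OF _ countable_rational_ordered_boxes[of n]])
    ultimately show "{x \<in> space ?S. x i < c} \<in> sets ?S" using Pow by (simp add: space_measure_of)
  qed
  then have "(\<lambda>x. x) \<in> measurable ?S (\<Pi>\<^sub>M i\<in>{1..n}. (lborel :: real measure))"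
    using Pow by (intro measurable_PiM_single') (auto simp: space_measure_of ordered_simplex_def PiE_iff)
  from measurable_sets[OF this X] show ?thesis using Pow by (simp add: space_measure_of)
qed

section \<open>The density\<close>

lemma half_open_box_sets [measurable]:
  "half_open_box n a b \<in> sets (\<Pi>\<^sub>M i\<in>{1..n}. (lborel :: real measure))"
  unfolding half_open_box_def by (intro sets_PiM_I_finite) auto

lemma ordered_simplex_sets [measurable]:
  assumes "1 \<le> n"
  shows "ordered_simplex n \<in> sets (\<Pi>\<^sub>M i\<in>{1..n}. (lborel :: real measure))"
proof -
  have "rational_ordered_boxes n \<subseteq> sets (\<Pi>\<^sub>M i\<in>{1..n}. (lborel :: real measure))"
  proof
    fix X assume "X \<in> rational_ordered_boxes n"
    then obtain a b where "X = half_open_box n a b" by (auto simp: rational_ordered_boxes_def)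
    then show "X \<in> sets (\<Pi>\<^sub>M i\<in>{1..n}. (lborel :: real measure))"
      by (simp only: half_open_box_sets)
  qed
  then show ?thesis
    unfolding ordered_simplex_eq_Union[OF assms]
    by (rule sets.countable_Union[OF countable_rational_ordered_boxes])
qed

definition nearest_density :: "real \<Rightarrow> nat \<Rightarrow> (nat \<Rightarrow> real) \<Rightarrow> ennreal" where
  "nearest_density l n x = (if 0 < x 1 \<and> strict_mono_on {1..n} x
     then ennreal ((2 * l) ^ n * exp (- 2 * l * x n)) else 0)"

lemma nearest_density_measurable [measurable]:
  assumes "1 \<le> n"
  shows "nearest_density l n \<in> borel_measurable (\<Pi>\<^sub>M i\<in>{1..n}. lborel)"
proof -
  have [measurable]: "1 \<in> {1..n}" "n \<in> {1..n}" using assms by auto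
  have [measurable]: "Suc j \<in> {1..n}" "j \<in> {1..n}" if "j \<in> {1..<n}" for j using that by auto
  show ?thesis
    unfolding nearest_density_def strict_mono_on_nat_atLeastAtMost_iff by measurable
qed

section \<open>Exponential integrals, total mass and masses of boxes\<close>

lemma nn_integral_exp_Ioc:
  fixes c a b :: real
  assumes "0 < c" "a \<le> b"
  shows "(\<integral>\<^sup>+y. ennreal (c * exp (- c * y)) * indicator {a<..b} y \<partial>lborel) =
    ennreal (exp (- c * a) - exp (- c * b))"
proof -
  \<comment> \<open>The left endpoint is a null set, so the interval may be closed to fit the
    fundamental theorem of calculus.\<close>
  have "AE y in lborel. y \<noteq> a" by (rule AE_lborel_singleton)
  then have "(\<integral>\<^sup>+y. ennreal (c * exp (- c * y)) * indicator {a<..b} y \<partial>lborel) =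
      (\<integral>\<^sup>+y. ennreal (c * exp (- c * y)) * indicator {a..b} y \<partial>lborel)"
    by (intro nn_integral_cong_AE) (auto split: split_indicator)
  also have "\<dots> = ennreal ((- exp (- c * b)) - (- exp (- c * a)))"
    using assms by (intro nn_integral_FTC_Icc) (auto intro!: derivative_eq_intros)
  finally show ?thesis by simp
qed

lemma nn_integral_exp_Ioi:
  fixes c a :: real
  assumes "0 < c"
  shows "(\<integral>\<^sup>+y. ennreal (c * exp (- c * y)) * indicator {a<..} y \<partial>lborel) = ennreal (exp (- c * a))"
proof -
  have "AE y in lborel. y \<noteq> a" by (rule AE_lborel_singleton)
  then have "(\<integral>\<^sup>+y. ennreal (c * exp (- c * y)) * indicator {a<..} y \<partial>lborel) =
      (\<integral>\<^sup>+y. ennreal (c * exp (- c * y)) * indicator {a..} y \<partial>lborel)"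
    by (intro nn_integral_cong_AE) (auto split: split_indicator)
  also have "\<dots> = ennreal (0 - (- exp (- c * a)))"
  proof (rule nn_integral_FTC_atLeast)
    have "((\<lambda>x. - exp (- c * x)) \<longlongrightarrow> - 0) at_top"
      using assms by (intro tendsto_minus filterlim_compose[OF exp_at_bot]
        filterlim_tendsto_neg_mult_at_bot[OF tendsto_const] filterlim_ident) auto
    then show "((\<lambda>x. - exp (- c * x)) \<longlongrightarrow> 0) at_top" by simp
  qed (use assms in \<open>auto intro!: derivative_eq_intros\<close>)
  finally show ?thesis by simp
qed

text \<open>The last two factors form the density of \<open>x n\<close> plus an independent
  exponential gap of rate \<open>2 * l\<close>. Only the final factor depends on \<open>y\<close>,
  so the new coordinate can be integrated out first.\<close>

lemma nearest_density_Suc: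
  assumes "0 < l" "1 \<le> n"
  shows "nearest_density l (Suc n) (x(Suc n := y)) =
    nearest_density l n x * ennreal (exp (2 * l * x n)) *
      (ennreal ((2 * l) * exp (- (2 * l) * y)) * indicator {x n<..} y)"
proof -
  have "strict_mono_on {1..Suc n} (x(Suc n := y)) \<longleftrightarrow> strict_mono_on {1..n} x \<and> x n < y"
    unfolding strict_mono_on_nat_atLeastAtMost_iff using assms(2)
    by (auto simp: atLeastLessThanSuc fun_upd_def)
  moreover have "(2 * l) ^ Suc n * exp (- (2 * l * y)) =
    (2 * l) ^ n * exp (- (2 * l * x n)) * exp (2 * l * x n) * (2 * l * exp (- (2 * l * y)))"
    by (simp flip: exp_add mult.assoc)
  ultimately show ?thesis
    using assms by (auto simp: nearest_density_def ennreal_mult[symmetric] simp flip: mult.assoc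
      split: split_indicator)
qed

text \<open>By induction: integrating out the last coordinate gives
  \<open>exp (- (2 * l) * x n)\<close>, which cancels the compensating factor in
  \<open>nearest_density_Suc\<close>.\<close>

lemma nn_integral_nearest_density:
  assumes "0 < l" "1 \<le> n"
  shows "(\<integral>\<^sup>+x. nearest_density l n x \<partial>(\<Pi>\<^sub>M i\<in>{1..n}. lborel)) = 1"
  using \<open>1 \<le> n\<close>
proof (induction n rule: dec_induct)
  interpret product_sigma_finite "\<lambda>_::nat. lborel :: real measure" ..
  case base
  have "nearest_density l 1 x = ennreal ((2 * l) * exp (- (2 * l) * x 1)) * indicator {0<..} (x 1)" for x
    by (auto simp: nearest_density_def strict_mono_on_def split: split_indicator)
  then have "(\<integral>\<^sup>+x. nearest_density l 1 x \<partial>(\<Pi>\<^sub>M i\<in>{1..1}. lborel)) =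
    (\<integral>\<^sup>+y. ennreal ((2 * l) * exp (- (2 * l) * y)) * indicator {0<..} y \<partial>lborel)"
    using product_nn_integral_singleton[of
      "\<lambda>y. ennreal ((2 * l) * exp (- (2 * l) * y)) * indicator {0<..} y" 1] by simp
  then show ?case using nn_integral_exp_Ioi[of "2 * l" 0] assms by simp
next
  interpret product_sigma_finite "\<lambda>_::nat. lborel :: real measure" ..
  case (step n)
  have "(\<integral>\<^sup>+x. nearest_density l (Suc n) x \<partial>(\<Pi>\<^sub>M i\<in>insert (Suc n) {1..n}. lborel)) =
    (\<integral>\<^sup>+x. \<integral>\<^sup>+y. nearest_density l (Suc n) (x(Suc n := y)) \<partial>lborel \<partial>(\<Pi>\<^sub>M i\<in>{1..n}. lborel))"
    using nearest_density_measurable[of "Suc n" l] step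
    by (intro product_nn_integral_insert) (auto simp: atLeastAtMostSuc_conv)
  also have "\<dots> = (\<integral>\<^sup>+x. nearest_density l n x \<partial>(\<Pi>\<^sub>M i\<in>{1..n}. lborel))"
  proof (rule nn_integral_cong)
    fix x :: "nat \<Rightarrow> real"
    have "(\<integral>\<^sup>+y. nearest_density l (Suc n) (x(Suc n := y)) \<partial>lborel) =
      nearest_density l n x * ennreal (exp (2 * l * x n)) * ennreal (exp (- (2 * l) * x n))"
      using assms step nn_integral_exp_Ioi[of "2 * l" "x n"]
      by (simp add: nearest_density_Suc nn_integral_cmult)
    also have "\<dots> = nearest_density l n x"
      by (simp add: mult.assoc ennreal_mult[symmetric] flip: exp_add)
    finally show "(\<integral>\<^sup>+y. nearest_density l (Suc n) (x(Suc n := y)) \<partial>lborel) = nearest_density l n x" .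
  qed
  finally show ?case using step by (simp add: atLeastAtMostSuc_conv)
qed

text \<open>Inside the box the ordering constraint holds automatically, so the density factorises
  over the coordinates: a constant \<open>2 * l\<close> for each \<open>i < n\<close>, and an
  exponential density for the last one.\<close>

lemma emeasure_nearest_density_box:
  assumes "0 < l" "1 \<le> n" and ab: "ordered_bounds n a b"
  shows "emeasure (density (\<Pi>\<^sub>M i\<in>{1..n}. lborel) (nearest_density l n)) (half_open_box n a b) =
    ennreal ((\<Prod>i\<in>{1..<n}. 2 * l * (b i - a i)) * (exp (- (2 * l) * a n) - exp (- (2 * l) * b n)))"
proof -
  interpret product_sigma_finite "\<lambda>_::nat. lborel :: real measure" ..
  define f where "f i y = (if i < n then ennreal (2 * l) else ennreal (2 * l * exp (- (2 * l) * y))) *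
    indicator {a i<..b i} y" for i y
  have le: "a i \<le> b i" if "i \<in> {1..n}" for i using ab that by (simp add: ordered_bounds_def)
  have n: "{1..n} = insert n {1..<n}" using assms by auto
  have "nearest_density l n x * indicator (half_open_box n a b) x = (\<Prod>i\<in>{1..n}. f i (x i))"
    if x: "x \<in> space (\<Pi>\<^sub>M i\<in>{1..n}. (lborel :: real measure))" for x
  proof (cases "x \<in> half_open_box n a b")
    case True
    then have "x \<in> ordered_simplex n" using half_open_box_subset_simplex[OF \<open>1 \<le> n\<close> ab] by blast
    then have density: "nearest_density l n x = ennreal ((2 * l) ^ n * exp (- 2 * l * x n))"
      by (simp add: nearest_density_def ordered_simplex_def)
    have "f i (x i) = (if i < n then ennreal (2 * l) else ennreal (2 * l * exp (- (2 * l) * x i)))"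
      if "i \<in> {1..n}" for i using True that by (auto simp: f_def half_open_box_def PiE_iff)
    then have "(\<Prod>i\<in>{1..n}. f i (x i)) =
        (\<Prod>i\<in>{1..n}. if i < n then ennreal (2 * l) else ennreal (2 * l * exp (- (2 * l) * x i)))"
      by (rule prod.cong[OF refl])
    also have "\<dots> = ennreal (2 * l * exp (- (2 * l) * x n)) * ennreal (2 * l) ^ (n - 1)"
      unfolding n by (subst prod.insert) auto
    also have "\<dots> = ennreal ((2 * l) ^ n * exp (- 2 * l * x n))"
      using assms by (cases n) (auto simp: ennreal_power ennreal_mult[symmetric] mult_ac)
    finally show ?thesis using True density by simp
  next
    case False
    then obtain i where i: "i \<in> {1..n}" "x i \<notin> {a i<..b i}"
      using x by (auto simp: half_open_box_def space_PiM PiE_iff)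
    then have "f i (x i) = 0" by (simp add: f_def)
    then have "(\<Prod>i\<in>{1..n}. f i (x i)) = 0" using i(1) by (intro prod_zero) auto
    then show ?thesis using False by simp
  qed
  then have "emeasure (density (\<Pi>\<^sub>M i\<in>{1..n}. lborel) (nearest_density l n)) (half_open_box n a b) =
      (\<integral>\<^sup>+x. (\<Prod>i\<in>{1..n}. f i (x i)) \<partial>(\<Pi>\<^sub>M i\<in>{1..n}. lborel))"
    using assms nearest_density_measurable[of n l] half_open_box_sets[of n a b]
    by (subst emeasure_density) (auto intro!: nn_integral_cong simp del: One_nat_def)
  also have "\<dots> = (\<Prod>i\<in>{1..n}. \<integral>\<^sup>+y. f i y \<partial>lborel)"
    by (intro product_nn_integral_prod) (auto simp: f_def)
  also have "\<dots> = (\<integral>\<^sup>+y. f n y \<partial>lborel) * (\<Prod>i\<in>{1..<n}. \<integral>\<^sup>+y. f i y \<partial>lborel)"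
    unfolding n by simp
  also have "(\<integral>\<^sup>+y. f n y \<partial>lborel) = ennreal (exp (- (2 * l) * a n) - exp (- (2 * l) * b n))"
    using nn_integral_exp_Ioc[of "2 * l" "a n" "b n"] le[of n] assms by (simp add: f_def)
  also have "(\<Prod>i\<in>{1..<n}. \<integral>\<^sup>+y. f i y \<partial>lborel) = (\<Prod>i\<in>{1..<n}. ennreal (2 * l * (b i - a i)))"
    using le assms by (intro prod.cong) (auto simp: f_def nn_integral_cmult ennreal_mult)
  also have "\<dots> = ennreal (\<Prod>i\<in>{1..<n}. 2 * l * (b i - a i))"
    using le assms by (intro prod_ennreal) auto
  also have "ennreal (exp (- (2 * l) * a n) - exp (- (2 * l) * b n)) * \<dots> =
    ennreal ((\<Prod>i\<in>{1..<n}. 2 * l * (b i - a i)) * (exp (- (2 * l) * a n) - exp (- (2 * l) * b n)))"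
    using le assms by (subst ennreal_mult[symmetric]) (auto intro!: prod_nonneg simp: mult.commute)
  finally show ?thesis .
qed

section \<open>Counting points in balls and annuli\<close>

text \<open>The infimum is attained, since local finiteness makes the number of points in a ball
  right-continuous in the radius. The assumption \<open>ex\<close> excludes the infimum of the empty
  set.\<close>

lemma nearest_dist_le_iff:
  assumes fin: "\<And>r. finite (S \<inter> cball 0 r)" and "1 \<le> i"
    and ex: "i \<le> card (S \<inter> cball 0 s)"
  shows "nearest_dist S i \<le> r \<longleftrightarrow> i \<le> card (S \<inter> cball 0 r)"
proof -
  let ?R = "{r. 0 \<le> r \<and> i \<le> card (S \<inter> cball 0 r)}"
  have nonneg: "0 \<le> r" if "i \<le> card (S \<inter> cball 0 r)" for r
    using that \<open>1 \<le> i\<close> by (cases "r < 0") auto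
  have "bdd_below ?R" by (rule bdd_belowI[of _ 0]) auto
  have "?R \<noteq> {}" using ex nonneg by auto
  show ?thesis
  proof
    assume "i \<le> card (S \<inter> cball 0 r)"
    then show "nearest_dist S i \<le> r"
      using nonneg \<open>bdd_below ?R\<close> by (auto simp: nearest_dist_def intro: cInf_lower)
  next
    assume le: "nearest_dist S i \<le> r"
    show "i \<le> card (S \<inter> cball 0 r)"
    proof (rule ccontr)
      assume less: "\<not> i \<le> card (S \<inter> cball 0 r)"
      \<comment> \<open>These are the radii in \<open>(r, r + 1]\<close> at which the count jumps,
        together with \<open>r + 1\<close> to make the set nonempty. Balls of radius below
        \<open>Min F\<close> contain no points beyond those in the ball of radius
        \<open>r\<close>.\<close>
      define F where "F = insert (r + 1) (abs ` {q \<in> S \<inter> cball 0 (r + 1). r < \<bar>q\<bar>})"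
      have "finite {q \<in> S \<inter> cball 0 (r + 1). r < \<bar>q\<bar>}"
        using fin[of "r + 1"] by (rule rev_finite_subset) auto
      then have F: "finite F" "F \<noteq> {}" by (simp_all add: F_def)
      have "\<forall>d\<in>F. r < d" by (auto simp: F_def)
      then have "r < Min F" using F by simp
      also have "Min F \<le> Inf ?R"
      proof (rule cInf_greatest[OF \<open>?R \<noteq> {}\<close>])
        fix s assume s: "s \<in> ?R"
        show "Min F \<le> s"
        proof (rule ccontr)
          assume "\<not> Min F \<le> s"
          then have lt: "\<And>d. d \<in> F \<Longrightarrow> s < d" using F by (meson Min_le less_le_trans not_le)
          have "S \<inter> cball 0 s \<subseteq> S \<inter> cball 0 r"
          proof
            fix q assume q: "q \<in> S \<inter> cball 0 s"
            then have "\<bar>q\<bar> \<notin> F" using lt by fastforce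
            moreover have "\<bar>q\<bar> \<le> r + 1" using q lt[of "r + 1"] by (auto simp: F_def)
            ultimately show "q \<in> S \<inter> cball 0 r" using q by (auto simp: F_def)
          qed
          from card_mono[OF fin this] s less show False by simp
        qed
      qed
      finally show False using le by (simp add: nearest_dist_def)
    qed
  qed
qed

text \<open>The innermost annulus includes the origin, so that the annuli partition a ball.\<close>

definition annulus :: "(nat \<Rightarrow> real) \<Rightarrow> nat \<Rightarrow> real set" where
  "annulus t j = cball 0 (t (Suc j)) - (if j = 0 then {} else cball 0 (t j))"

lemma annulus_borel: "annulus t j \<in> sets borel"
  by (auto simp: annulus_def)

lemma bounded_annulus: "bounded (annulus t j)"
  by (auto simp: annulus_def intro: bounded_subset[OF bounded_cball])

lemma sum_card_annulus:
  assumes "mono_on {..m} t" and fin: "\<And>r. finite (S \<inter> cball 0 r)"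
  shows "j < m \<Longrightarrow> (\<Sum>k<Suc j. card (S \<inter> annulus t k)) = card (S \<inter> cball 0 (t (Suc j)))"
proof (induction j)
  case 0
  then show ?case by (simp add: annulus_def)
next
  case (Suc j)
  have "t (Suc j) \<le> t (Suc (Suc j))" using assms(1) Suc.prems by (auto simp: mono_on_def)
  then have "S \<inter> cball 0 (t (Suc (Suc j))) = (S \<inter> cball 0 (t (Suc j))) \<union> (S \<inter> annulus t (Suc j))"
    by (auto simp: annulus_def)
  moreover have "finite (S \<inter> annulus t (Suc j))"
    using fin by (rule rev_finite_subset) (auto simp: annulus_def)
  ultimately have "card (S \<inter> cball 0 (t (Suc (Suc j)))) =
      card (S \<inter> cball 0 (t (Suc j))) + card (S \<inter> annulus t (Suc j))"
    using fin by (simp add: card_Un_disjoint annulus_def disjoint_iff)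
  then show ?case using Suc by simp
qed

lemma disjoint_annulus:
  assumes "mono_on {..m} t"
  shows "disjoint_family_on (annulus t) {..<m}"
proof -
  have "annulus t j \<inter> annulus t k = {}" if "j < k" "k < m" for j k
  proof -
    have "t (Suc j) \<le> t k" using assms that by (auto simp: mono_on_def)
    then show ?thesis using that by (auto simp: annulus_def)
  qed
  then show ?thesis
    unfolding disjoint_family_on_def by (metis Int_commute lessThan_iff linorder_neqE_nat)
qed

text \<open>Because \<open>t 0 = 0\<close>, the full innermost ball obeys the same formula as the
  proper annuli.\<close>

lemma measure_annulus:
  assumes "mono_on {..m} t" "t 0 = 0" "j < m"
  shows "measure lborel (annulus t j) = 2 * (t (Suc j) - t j)"
proof -
  have cball: "measure lborel (cball 0 r :: real set) = 2 * r" if "0 \<le> r" for r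
    using that by (simp add: cball_eq_atLeastAtMost)
  have t: "0 \<le> t j" "t j \<le> t (Suc j)"
    using assms monotone_onD[OF assms(1), of 0 j] monotone_onD[OF assms(1), of j "Suc j"] by auto
  show ?thesis
  proof (cases "j = 0")
    case True
    then show ?thesis using cball t assms(2) by (simp add: annulus_def)
  next
    case False
    have "measure lborel (cball 0 (t (Suc j)) - cball 0 (t j) :: real set) =
      measure lborel (cball 0 (t (Suc j)) :: real set) - measure lborel (cball 0 (t j) :: real set)"
      using t by (intro measure_Diff) (auto simp: cball_eq_atLeastAtMost)
    then show ?thesis using False cball t by (simp add: annulus_def)
  qed
qed

text \<open>Here \<open>c j\<close> is the number of points in the \<open>j\<close>-th annulus; the left-hand side says that the
  \<open>i\<close>-th distance, counted from 0, lies between the radii \<open>t (2 * i + 1)\<close> and \<open>t (2 * i + 2)\<close>.\<close>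

lemma interlacing_counts_iff:
  fixes c :: "nat \<Rightarrow> nat"
  shows "(\<forall>i<n. (\<Sum>k<2*i+1. c k) \<le> i \<and> Suc i \<le> (\<Sum>k<2*i+2. c k)) \<longleftrightarrow>
    (\<forall>j<2*n. c j \<in> (if even j then {0} else if j = 2*n-1 then {1..} else {1}))"
    (is "?L \<longleftrightarrow> ?R")
proof
  assume L: ?L
  \<comment> \<open>A squeeze: the lower bound for \<open>i - 1\<close> says that the sum is at
    least \<open>i\<close>, the upper bound for \<open>i\<close> that it is at most \<open>i\<close>
    even after adding \<open>c (2*i)\<close>.\<close>
  have S: "(\<Sum>k<2*i. c k) = i \<and> c (2*i) = 0" if "i < n" for i
  proof -
    have "i \<le> (\<Sum>k<2*i. c k)"
    proof (cases i)
      case (Suc i')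
      then show ?thesis using L[rule_format, of i'] that by auto
    qed simp
    then show ?thesis using L[rule_format, OF that] by auto
  qed
  show ?R
  proof (intro allI impI)
    fix j assume j: "j < 2*n"
    show "c j \<in> (if even j then {0} else if j = 2*n-1 then {1..} else {1})"
    proof (cases "even j")
      case True
      then obtain i where "j = 2*i" by auto
      then show ?thesis using S[of i] j by simp
    next
      case False
      then obtain i where i: "j = 2*i+1" by (auto elim: oddE)
      have "Suc i \<le> (\<Sum>k<2*i+2. c k)" using L j i by auto
      then have "1 \<le> c j" using S[of i] j i by auto
      \<comment> \<open>The next partial sum pins the count down to 1. Nothing follows the last odd
        index, where only the lower bound remains.\<close>
      moreover have "c j = 1" if "Suc i < n"
        using S[of i] S[of "Suc i"] that i by auto
      ultimately show ?thesis using False i j by auto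
    qed
  qed
next
  assume R: ?R
  have even: "c (2*i) = 0" if "i < n" for i using R[rule_format, of "2*i"] that by simp
  have odd1: "c (2*i+1) = 1" if "Suc i < n" for i
  proof -
    have "2*i+1 \<noteq> 2*n-1" "2*i+1 < 2*n" using that by auto
    then show ?thesis using R[rule_format, of "2*i+1"] by simp
  qed
  have odd: "1 \<le> c (2*i+1)" if "i < n" for i
    using R[rule_format, of "2*i+1"] that by (auto split: if_splits)
  have "(\<Sum>k<2*i. c k) = i" if "i < n" for i
    using that
  proof (induction i)
    case (Suc i)
    then show ?case using even[of i] odd1[of i] by simp
  qed simp
  then show ?L using even odd by fastforce
qed

section \<open>Telescoping products and the merged sequence of endpoints\<close>

lemma prod_lessThan_double:
  fixes p :: "nat \<Rightarrow> 'a::comm_monoid_mult"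
  shows "(\<Prod>j<2*n. p j) = (\<Prod>i<n. p (2*i) * p (2*i+1))"
  by (induction n) (auto simp: mult_ac)

text \<open>With \<open>c\<close> twice the rate, each factor pairs the probability of no point in
  an even annulus with that of exactly one point in the following odd annulus. All exponents
  together telescope from \<open>t 0 = 0\<close> to \<open>t (2*m)\<close>.\<close>

lemma prod_exp_telescope:
  fixes t :: "nat \<Rightarrow> real"
  assumes "t 0 = 0"
  shows "(\<Prod>i<m. exp (- (c * (t (2*i+1) - t (2*i)))) *
      (c * (t (2*i+2) - t (2*i+1)) * exp (- (c * (t (2*i+2) - t (2*i+1)))))) =
    (\<Prod>i<m. c * (t (2*i+2) - t (2*i+1))) * exp (- c * t (2*m))"
proof (induction m)
  case (Suc m)
  have "exp (- (c * t (2*m+2))) = exp (- (c * t (2*m))) * exp (- (c * (t (2*m+1) - t (2*m)))) *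
    exp (- (c * (t (2*m+2) - t (2*m+1))))"
    by (simp add: algebra_simps flip: exp_add)
  with Suc show ?case by (simp add: mult_ac)
qed (simp add: assms)

text \<open>This is the sequence \<open>0, a 1, b 1, a 2, b 2, ...\<close>. Annuli of even index are
  thus the gaps between the intervals, and the annulus of index \<open>2*i+1\<close> belongs to
  \<open>{a (Suc i)<..b (Suc i)}\<close>.\<close>

definition endpoints :: "(nat \<Rightarrow> real) \<Rightarrow> (nat \<Rightarrow> real) \<Rightarrow> nat \<Rightarrow> real" where
  "endpoints a b j = (if j = 0 then 0 else if odd j then a (Suc (j div 2)) else b (j div 2))"

lemma endpoints_simps:
  "endpoints a b 0 = 0" "endpoints a b (Suc (2 * i)) = a (Suc i)"
  "endpoints a b (Suc (Suc (2 * i))) = b (Suc i)"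
  by (simp_all add: endpoints_def)

lemma mono_on_atMost_nat:
  fixes t :: "nat \<Rightarrow> 'a::order"
  assumes "\<And>j. j < m \<Longrightarrow> t j \<le> t (Suc j)"
  shows "mono_on {..m} t"
proof (rule monotone_onI)
  fix r s :: nat assume "s \<in> {..m}" "r \<le> s"
  from this(2,1) show "t r \<le> t s"
  proof (induction s rule: dec_induct)
    case (step n)
    then show ?case using assms[of n] by (auto intro: order_trans)
  qed simp
qed

lemma mono_endpoints:
  assumes "ordered_bounds n a b"
  shows "mono_on {..2*n} (endpoints a b)"
proof (rule mono_on_atMost_nat)
  fix j assume j: "j < 2*n"
  show "endpoints a b j \<le> endpoints a b (Suc j)"
  proof (cases "even j")
    case True
    then obtain i where "j = 2*i" by auto
    then show ?thesis using assms j
      by (cases i) (auto simp: endpoints_def ordered_bounds_def)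
  next
    case False
    then obtain i where "j = 2*i+1" by (auto elim: oddE)
    then show ?thesis using assms j by (auto simp: endpoints_def ordered_bounds_def)
  qed
qed

section \<open>The distribution of the distances\<close>

context homogeneous_poisson_process
begin

lemma finite_Int_cball: "\<omega> \<in> space M \<Longrightarrow> finite (\<Phi> \<omega> \<inter> cball 0 r)"
  by (rule locally_finite) auto

lemma measurable_count_cball [measurable]:
  "(\<lambda>\<omega>. card (\<Phi> \<omega> \<inter> cball 0 r)) \<in> measurable M (count_space UNIV)"
  by (rule count_measurable) auto

lemma measurable_count_annulus [measurable]:
  "(\<lambda>\<omega>. card (\<Phi> \<omega> \<inter> annulus t j)) \<in> measurable M (count_space UNIV)"
  by (rule count_measurable[OF annulus_borel bounded_annulus])

text \<open>Where there are fewer than \<open>i\<close> points, the distance is the fixed real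
  \<open>Inf {}\<close>; elsewhere \<open>nearest_dist_le_iff\<close> turns the event into one about
  a count.\<close>

lemma nearest_dist_measurable [measurable]:
  assumes "1 \<le> i"
  shows "(\<lambda>\<omega>. nearest_dist (\<Phi> \<omega>) i) \<in> borel_measurable M"
  unfolding borel_measurable_iff_le
proof
  fix r :: real
  \<comment> \<open>Natural radii keep the quantifier countable, so that the event is
    measurable.\<close>
  define P where "P \<omega> \<longleftrightarrow> (\<exists>k::nat. i \<le> card (\<Phi> \<omega> \<inter> cball 0 (real k)))" for \<omega>
  have "nearest_dist (\<Phi> \<omega>) i \<le> r \<longleftrightarrow>
      (if P \<omega> then i \<le> card (\<Phi> \<omega> \<inter> cball 0 r) else Inf {} \<le> r)" if \<omega>: "\<omega> \<in> space M" for \<omega>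
  proof (cases "P \<omega>")
    case True
    then show ?thesis
      using nearest_dist_le_iff[OF finite_Int_cball[OF \<omega>] assms] by (auto simp: P_def)
  next
    case False
    have "\<not> i \<le> card (\<Phi> \<omega> \<inter> cball 0 s)" for s
    proof
      assume i: "i \<le> card (\<Phi> \<omega> \<inter> cball 0 s)"
      obtain k :: nat where "s \<le> real k" using real_arch_simple by blast
      then have "\<Phi> \<omega> \<inter> cball 0 s \<subseteq> \<Phi> \<omega> \<inter> cball 0 (real k)" by auto
      from card_mono[OF finite_Int_cball[OF \<omega>] this] i False show False
        by (auto simp: P_def intro: order_trans)
    qed
    then show ?thesis using False by (simp add: nearest_dist_def)
  qed
  then have "{\<omega> \<in> space M. nearest_dist (\<Phi> \<omega>) i \<le> r} =
      {\<omega> \<in> space M. if P \<omega> then i \<le> card (\<Phi> \<omega> \<inter> cball 0 r) else Inf {} \<le> r}" by auto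
  also have "\<dots> \<in> sets M" unfolding P_def by measurable
  finally show "{\<omega> \<in> space M. nearest_dist (\<Phi> \<omega>) i \<le> r} \<in> sets M" .
qed

text \<open>The exceptional event has at most the probability of fewer than \<open>n\<close> points
  in the ball of radius \<open>k\<close>, for every \<open>k\<close>. This is a finite sum of
  Poisson weights, each of which vanishes as \<open>k\<close> grows.\<close>

lemma AE_count_cball_ge:
  assumes "0 < rate"
  shows "AE \<omega> in M. \<exists>k::nat. n \<le> card (\<Phi> \<omega> \<inter> cball 0 (real k))"
proof -
  let ?A = "{\<omega> \<in> space M. \<forall>k::nat. \<not> n \<le> card (\<Phi> \<omega> \<inter> cball 0 (real k))}"
  have "prob ?A \<le> (\<Sum>i<n. (2 * rate * real k) ^ i / fact i * exp (- (2 * rate * real k)))" for k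
  proof -
    have "prob ?A \<le> prob (\<Union>i<n. {\<omega> \<in> space M. card (\<Phi> \<omega> \<inter> cball 0 (real k)) = i})"
      by (intro finite_measure_mono) (auto simp: not_le)
    also have "\<dots> \<le> (\<Sum>i<n. prob {\<omega> \<in> space M. card (\<Phi> \<omega> \<inter> cball 0 (real k)) = i})"
      by (intro finite_measure_subadditive_finite) auto
    also have "\<dots> = (\<Sum>i<n. (2 * rate * real k) ^ i / fact i * exp (- (2 * rate * real k)))"
      by (intro sum.cong refl, subst count_eq) (auto simp: cball_eq_atLeastAtMost mult_ac)
    finally show ?thesis .
  qed
  moreover have "(\<lambda>k. \<Sum>i<n. (2 * rate * real k) ^ i / fact i * exp (- (2 * rate * real k))) \<longlonglongrightarrow> 0"
  proof (rule tendsto_null_sum)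
    fix i
    have "filterlim (\<lambda>k. 2 * rate * real k) at_top sequentially"
      using assms by (intro filterlim_tendsto_pos_mult_at_top[OF tendsto_const]
        filterlim_real_sequentially) auto
    from tendsto_mult_left[OF filterlim_compose[OF tendsto_power_div_exp_0 this], of "1 / fact i" i]
    show "(\<lambda>k. (2 * rate * real k) ^ i / fact i * exp (- (2 * rate * real k))) \<longlonglongrightarrow> 0"
      by (simp add: exp_minus field_simps)
  qed
  ultimately have "prob ?A \<le> 0" by (intro LIMSEQ_le_const) auto
  then have "prob ?A = 0" using measure_nonneg[of M ?A] by linarith
  then have "?A \<in> null_sets M" by (auto simp: null_sets_def emeasure_eq_measure)
  then show ?thesis by (rule AE_I') auto
qed

section \<open>Poisson probabilities for the annuli\<close>

lemma prob_annuli: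
  assumes "mono_on {..m} t" "0 < m"
  shows "prob {\<omega> \<in> space M. \<forall>j<m. card (\<Phi> \<omega> \<inter> annulus t j) \<in> C j} =
    (\<Prod>j<m. prob {\<omega> \<in> space M. card (\<Phi> \<omega> \<inter> annulus t j) \<in> C j})"
proof -
  have ind: "indep_vars (\<lambda>_. count_space UNIV) (\<lambda>j \<omega>. card (\<Phi> \<omega> \<inter> annulus t j)) {..<m}"
    using disjoint_annulus[OF assms(1)] annulus_borel bounded_annulus
    by (intro count_indep) auto
  have "prob (\<Inter>j\<in>{..<m}. (\<lambda>\<omega>. card (\<Phi> \<omega> \<inter> annulus t j)) -` C j \<inter> space M) =
      (\<Prod>j\<in>{..<m}. prob ((\<lambda>\<omega>. card (\<Phi> \<omega> \<inter> annulus t j)) -` C j \<inter> space M))"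
    using assms(2) by (intro indep_varsD[OF ind]) auto
  \<comment> \<open>For \<open>m = 0\<close> the intersection would be \<open>UNIV\<close> instead
    of \<open>space M\<close>.\<close>
  moreover have "(\<Inter>j\<in>{..<m}. (\<lambda>\<omega>. card (\<Phi> \<omega> \<inter> annulus t j)) -` C j \<inter> space M) =
      {\<omega> \<in> space M. \<forall>j<m. card (\<Phi> \<omega> \<inter> annulus t j) \<in> C j}"
    using assms(2) by auto
  ultimately show ?thesis by (simp add: vimage_def Int_def conj_commute)
qed

lemma prob_count_annulus_eq:
  assumes "mono_on {..m} t" "t 0 = 0" "j < m"
  shows "prob {\<omega> \<in> space M. card (\<Phi> \<omega> \<inter> annulus t j) = k} =
    (2 * rate * (t (Suc j) - t j)) ^ k / fact k * exp (- (2 * rate * (t (Suc j) - t j)))"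
  using count_eq[OF annulus_borel bounded_annulus, of t j k] measure_annulus[OF assms]
  by (simp add: mult_ac)

lemma prob_count_annulus_ge_1:
  assumes "mono_on {..m} t" "t 0 = 0" "j < m"
  shows "prob {\<omega> \<in> space M. 1 \<le> card (\<Phi> \<omega> \<inter> annulus t j)} =
    1 - exp (- (2 * rate * (t (Suc j) - t j)))"
proof -
  have "{\<omega> \<in> space M. 1 \<le> card (\<Phi> \<omega> \<inter> annulus t j)} =
      space M - {\<omega> \<in> space M. card (\<Phi> \<omega> \<inter> annulus t j) = 0}" by auto
  then have "prob {\<omega> \<in> space M. 1 \<le> card (\<Phi> \<omega> \<inter> annulus t j)} =
      1 - prob {\<omega> \<in> space M. card (\<Phi> \<omega> \<inter> annulus t j) = 0}"
    by (simp only:) (rule prob_compl, measurable)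
  then show ?thesis by (simp only: prob_count_annulus_eq[OF assms]) simp
qed

section \<open>The law of the vector of distances\<close>

abbreviation nearest_dists :: "nat \<Rightarrow> 'w \<Rightarrow> nat \<Rightarrow> real" where
  "nearest_dists n \<omega> \<equiv> \<lambda>i\<in>{1..n}. nearest_dist (\<Phi> \<omega>) i"

lemma nearest_dists_measurable [measurable]:
  "nearest_dists n \<in> measurable M (\<Pi>\<^sub>M i\<in>{1..n}. lborel)"
  by (intro measurable_restrict) (simp add: nearest_dist_measurable)

text \<open>Bounds on distances become bounds on ball counts, which are partial sums of annulus
  counts; \<open>interlacing_counts_iff\<close> then gives a condition on each annulus separately,
  as independence requires.\<close>

lemma nearest_dists_in_box_iff:
  assumes \<omega>: "\<omega> \<in> space M" and ab: "ordered_bounds n a b"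
    and ex: "n \<le> card (\<Phi> \<omega> \<inter> cball 0 s)"
  shows "nearest_dists n \<omega> \<in> half_open_box n a b \<longleftrightarrow>
    (\<forall>j<2*n. card (\<Phi> \<omega> \<inter> annulus (endpoints a b) j) \<in>
      (if even j then {0} else if j = 2*n-1 then {1..} else {1}))"
proof -
  let ?N = "\<lambda>r. card (\<Phi> \<omega> \<inter> cball 0 r)" and ?c = "\<lambda>j. card (\<Phi> \<omega> \<inter> annulus (endpoints a b) j)"
  note fin = finite_Int_cball[OF \<omega>]
  have sum: "(\<Sum>k<2*i+1. ?c k) = ?N (a (Suc i))" "(\<Sum>k<2*i+2. ?c k) = ?N (b (Suc i))" if "i < n" for i
    using sum_card_annulus[OF mono_endpoints[OF ab] fin, of "2*i"]
      sum_card_annulus[OF mono_endpoints[OF ab] fin, of "2*i+1"] that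
    by (simp_all add: endpoints_simps)
  have "nearest_dists n \<omega> \<in> half_open_box n a b \<longleftrightarrow>
      (\<forall>i\<in>{1..n}. ?N (a i) < i \<and> i \<le> ?N (b i))"
  proof -
    have "nearest_dist (\<Phi> \<omega>) i \<le> r \<longleftrightarrow> i \<le> ?N r" if "i \<in> {1..n}" for i r
      using that ex by (intro nearest_dist_le_iff[OF fin, where s = s]) auto
    then show ?thesis by (simp add: half_open_box_def PiE_iff not_le[symmetric])
  qed
  also have "\<dots> \<longleftrightarrow> (\<forall>i<n. ?N (a (Suc i)) < Suc i \<and> Suc i \<le> ?N (b (Suc i)))"
    unfolding image_Suc_lessThan[symmetric] by auto
  also have "\<dots> \<longleftrightarrow> (\<forall>i<n. (\<Sum>k<2*i+1. ?c k) \<le> i \<and> Suc i \<le> (\<Sum>k<2*i+2. ?c k))"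
    by (simp only: sum less_Suc_eq_le cong: conj_cong imp_cong)
  finally show ?thesis by (simp only: interlacing_counts_iff)
qed

lemma prob_nearest_dists_box:
  assumes "0 < rate" "1 \<le> n" and ab: "ordered_bounds n a b"
  shows "prob {\<omega> \<in> space M. nearest_dists n \<omega> \<in> half_open_box n a b} =
    (\<Prod>i\<in>{1..<n}. 2 * rate * (b i - a i)) * (exp (- (2 * rate) * a n) - exp (- (2 * rate) * b n))"
proof -
  define t where "t = endpoints a b"
  define C where "C j = (if even j then {0} else if j = 2*n-1 then {1..} else {1::nat})" for j
  have mono: "mono_on {..2*n} t" and t0: "t 0 = 0"
    using mono_endpoints[OF ab] by (simp_all add: t_def endpoints_simps)
  \<comment> \<open>Splitting off index \<open>m\<close> isolates the last pair of annuli, where the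
    outer count is only required to be at least 1.\<close>
  obtain m where n: "n = Suc m" using assms(2) by (cases n) auto
  define p where "p j = prob {\<omega> \<in> space M. card (\<Phi> \<omega> \<inter> annulus t j) \<in> C j}" for j
  have "prob {\<omega> \<in> space M. nearest_dists n \<omega> \<in> half_open_box n a b} =
      prob {\<omega> \<in> space M. \<forall>j<2*n. card (\<Phi> \<omega> \<inter> annulus t j) \<in> C j}"
  proof (rule measure_eq_AE)
    show "AE \<omega> in M. \<omega> \<in> {\<omega> \<in> space M. nearest_dists n \<omega> \<in> half_open_box n a b} \<longleftrightarrow>
        \<omega> \<in> {\<omega> \<in> space M. \<forall>j<2*n. card (\<Phi> \<omega> \<inter> annulus t j) \<in> C j}"
      using AE_count_cball_ge[OF assms(1), of n] AE_space
    proof eventually_elim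
      case (elim \<omega>)
      then show ?case
        using nearest_dists_in_box_iff[OF _ ab] unfolding t_def C_def by blast
    qed
    show "{\<omega> \<in> space M. nearest_dists n \<omega> \<in> half_open_box n a b} \<in> sets M"
      using measurable_sets[OF nearest_dists_measurable half_open_box_sets, of n a b]
      by (simp add: vimage_def Int_def conj_commute)
    show "{\<omega> \<in> space M. \<forall>j<2*n. card (\<Phi> \<omega> \<inter> annulus t j) \<in> C j} \<in> sets M"
      by measurable
  qed
  also have "\<dots> = (\<Prod>j<2*n. p j)"
    unfolding p_def using assms(2) by (intro prob_annuli[OF mono]) auto
  also have "\<dots> = (\<Prod>i<m. p (2*i) * p (2*i+1)) * (p (2*m) * p (2*m+1))"
    unfolding prod_lessThan_double n by simp
  finally have prob: "prob {\<omega> \<in> space M. nearest_dists n \<omega> \<in> half_open_box n a b} =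
    (\<Prod>i<m. p (2*i) * p (2*i+1)) * (p (2*m) * p (2*m+1))" .
  have even: "p (2*i) = exp (- (2 * rate * (t (2*i+1) - t (2*i))))" if "i < n" for i
    using that prob_count_annulus_eq[OF mono t0, of "2*i" 0] by (simp add: p_def C_def)
  have odd: "p (2*i+1) = 2 * rate * (t (2*i+2) - t (2*i+1)) *
      exp (- (2 * rate * (t (2*i+2) - t (2*i+1))))" if "i < m" for i
    using that prob_count_annulus_eq[OF mono t0, of "2*i+1" 1] n by (simp add: p_def C_def)
  have last: "p (2*m+1) = 1 - exp (- (2 * rate * (t (2*m+2) - t (2*m+1))))"
    using prob_count_annulus_ge_1[OF mono t0, of "2*m+1"] n by (simp add: p_def C_def)
  have "(\<Prod>i<m. p (2*i) * p (2*i+1)) =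
      (\<Prod>i<m. 2 * rate * (t (2*i+2) - t (2*i+1))) * exp (- (2 * rate) * t (2*m))"
    unfolding prod_exp_telescope[where t = t, OF t0, symmetric]
    by (intro prod.cong refl arg_cong2[where f = "(*)"] even odd) (auto simp: n)
  also have "(\<Prod>i<m. 2 * rate * (t (2*i+2) - t (2*i+1))) = (\<Prod>i\<in>{1..<n}. 2 * rate * (b i - a i))"
    by (simp add: t_def endpoints_simps n lessThan_atLeast0 prod.atLeast_Suc_lessThan_Suc_shift
      del: prod.op_ivl_Suc)
  finally have inner: "(\<Prod>i<m. p (2*i) * p (2*i+1)) =
      (\<Prod>i\<in>{1..<n}. 2 * rate * (b i - a i)) * exp (- (2 * rate) * t (2*m))" .
  have ab_n: "t (2*m+1) = a n" "t (2*m+2) = b n" by (simp_all add: n t_def endpoints_simps)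
  \<comment> \<open>The empty last gap extends the telescoped exponent from \<open>t (2*m)\<close>
    to \<open>a n\<close>.\<close>
  have "exp (- (2 * rate) * t (2*m)) * p (2*m) = exp (- (2 * rate) * a n)"
    unfolding even[of m, unfolded n, OF lessI] ab_n exp_add[symmetric] by (simp add: right_diff_distrib)
  moreover have "exp (- (2 * rate) * a n) * p (2*m+1) = exp (- (2 * rate) * a n) - exp (- (2 * rate) * b n)"
    unfolding last ab_n right_diff_distrib[of "exp _"] exp_add[symmetric]
    by (simp add: right_diff_distrib)
  ultimately have outer: "exp (- (2 * rate) * t (2*m)) * (p (2*m) * p (2*m+1)) =
      exp (- (2 * rate) * a n) - exp (- (2 * rate) * b n)"
    by (simp only: mult.assoc[symmetric])
  show ?thesis unfolding prob inner outer[symmetric] by (simp only: mult.assoc)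
qed

lemma distr_nearest_dists:
  assumes "0 < rate" "1 \<le> n"
  shows "distr M (\<Pi>\<^sub>M i\<in>{1..n}. lborel) (nearest_dists n) =
    density (\<Pi>\<^sub>M i\<in>{1..n}. lborel) (nearest_density rate n)"
proof -
  let ?P = "\<Pi>\<^sub>M i\<in>{1..n}. (lborel :: real measure)" and ?\<Omega> = "ordered_simplex n"
  define D where "D = distr M ?P (nearest_dists n)"
  define Q where "Q = density ?P (nearest_density rate n)"
  interpret D: prob_space D
    unfolding D_def by (rule prob_space_distr) measurable
  have Q1: "emeasure Q (space Q) = 1"
    using nn_integral_nearest_density[OF assms] nearest_density_measurable[OF assms(2), of rate]
    by (simp add: Q_def emeasure_density space_density cong: nn_integral_cong_simp del: One_nat_def)
  interpret Q: prob_space Q by standard (rule Q1)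
  have sets: "sets D = sets ?P" "sets Q = sets ?P" by (simp_all add: D_def Q_def)
  have \<Omega>: "?\<Omega> \<in> sets ?P" by (rule ordered_simplex_sets[OF assms(2)])
  have box: "emeasure D X = emeasure Q X" if "X \<in> ordered_boxes n" for X
  proof -
    from that obtain a b where X: "X = half_open_box n a b" and ab: "ordered_bounds n a b"
      by (auto simp: ordered_boxes_def)
    have "emeasure D X = emeasure M (nearest_dists n -` X \<inter> space M)"
      unfolding D_def X by (intro emeasure_distr nearest_dists_measurable half_open_box_sets)
    also have "nearest_dists n -` X \<inter> space M = {\<omega> \<in> space M. nearest_dists n \<omega> \<in> X}" by auto
    also have "emeasure M \<dots> = emeasure Q X"
      unfolding Q_def X emeasure_eq_measure prob_nearest_dists_box[OF assms ab]
        emeasure_nearest_density_box[OF assms ab] ..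
    finally show ?thesis .
  qed
  have Pow: "ordered_boxes n \<subseteq> Pow ?\<Omega>"
    using half_open_box_subset_simplex[OF assms(2)] by (auto simp: ordered_boxes_def)
  have restrict: "sets (restrict_space N ?\<Omega>) = sigma_sets ?\<Omega> (ordered_boxes n)"
    if N: "sets N = sets ?P" for N
  proof
    show "sets (restrict_space N ?\<Omega>) \<subseteq> sigma_sets ?\<Omega> (ordered_boxes n)"
      using sigma_sets_ordered_boxes[OF assms(2)] N
      by (auto simp: sets_restrict_space Int_commute simp del: One_nat_def)
    have iff: "X \<in> sets (restrict_space N ?\<Omega>) \<longleftrightarrow> X \<subseteq> ?\<Omega> \<and> X \<in> sets N" for X
      using \<Omega> N by (intro sets_restrict_space_iff) auto
    have "ordered_boxes n \<subseteq> sets N"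
      unfolding N ordered_boxes_def by (blast intro: half_open_box_sets)
    then have "ordered_boxes n \<subseteq> sets (restrict_space N ?\<Omega>)"
      unfolding subset_iff iff using Pow by blast
    moreover have "?\<Omega> \<in> sets (restrict_space N ?\<Omega>)"
      unfolding iff using \<Omega> N by blast
    ultimately show "sigma_sets ?\<Omega> (ordered_boxes n) \<subseteq> sets (restrict_space N ?\<Omega>)"
      by (rule sets.sigma_sets_subset')
  qed
  have em_restrict: "emeasure (restrict_space N ?\<Omega>) X = emeasure N X"
    if "sets N = sets ?P" "X \<subseteq> ?\<Omega>" for N X
    using that \<Omega> by (intro emeasure_restrict_space) auto
  \<comment> \<open>Uniqueness of measures on an intersection-stable generator; the rational boxes
    serve as the countable cover by sets of finite measure.\<close>
  have "restrict_space D ?\<Omega> = restrict_space Q ?\<Omega>"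
  proof (rule measure_eqI_generator_eq_countable[where A = "rational_ordered_boxes n"])
    show "emeasure (restrict_space D ?\<Omega>) X = emeasure (restrict_space Q ?\<Omega>) X"
      if "X \<in> ordered_boxes n" for X
      using box[OF that] em_restrict[OF sets(1)] em_restrict[OF sets(2)] Pow that by auto
    show "emeasure (restrict_space D ?\<Omega>) X \<noteq> \<infinity>" if "X \<in> rational_ordered_boxes n" for X
    proof -
      have "X \<subseteq> ?\<Omega>" using that Pow rational_ordered_boxes_subset[of n] by auto
      then show ?thesis by (simp add: em_restrict[OF sets(1)])
    qed
  qed (rule Int_stable_ordered_boxes[OF assms(2)] Pow restrict[OF sets(1)] restrict[OF sets(2)]
      rational_ordered_boxes_subset ordered_simplex_eq_Union[OF assms(2), symmetric]
      countable_rational_ordered_boxes)+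
  then have simplex: "emeasure D X = emeasure Q X" if "X \<subseteq> ?\<Omega>" for X
    using em_restrict[OF sets(1) that] em_restrict[OF sets(2) that] by simp
  have AE_Q: "AE x in Q. x \<in> ?\<Omega>"
    unfolding Q_def AE_density[OF nearest_density_measurable[OF assms(2)]]
    by (rule AE_I2) (auto simp: nearest_density_def ordered_simplex_def space_PiM PiE_iff
      split: if_splits)
  then have "emeasure Q ?\<Omega> = 1"
    using \<Omega> sets by (subst (asm) Q.AE_in_set_eq_1) (auto simp: Q.emeasure_eq_measure)
  \<comment> \<open>All mass of \<open>Q\<close> lies in the simplex and \<open>D\<close> agrees
    with \<open>Q\<close> there. As \<open>D\<close> is a probability measure, nothing is left for
    it outside.\<close>
  then have "emeasure D ?\<Omega> = 1" using simplex by simp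
  then have AE_D: "AE x in D. x \<in> ?\<Omega>"
    using \<Omega> sets by (subst D.AE_in_set_eq_1) (auto simp: D.emeasure_eq_measure)
  show ?thesis
    unfolding D_def[symmetric] Q_def[symmetric]
  proof (rule measure_eqI)
    fix X assume "X \<in> sets D"
    then have X: "X \<in> sets D" "X \<in> sets Q" "X \<inter> ?\<Omega> \<in> sets D" "X \<inter> ?\<Omega> \<in> sets Q"
      using sets \<Omega> by auto
    have "emeasure D X = emeasure D (X \<inter> ?\<Omega>)"
      using AE_D X by (intro emeasure_eq_AE) auto
    also have "\<dots> = emeasure Q (X \<inter> ?\<Omega>)" by (rule simplex) simp
    also have "\<dots> = emeasure Q X"
      using AE_Q X by (intro emeasure_eq_AE) auto
    finally show "emeasure D X = emeasure Q X" .
  qed (simp add: sets)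
qed

end

theorem lemma1:
  fixes M :: "'w measure" and lambda_D :: real and \<Phi> :: "'w \<Rightarrow> real set" and n :: nat
  assumes "homogeneous_poisson_process M lambda_D \<Phi>"
    and "lambda_D > 0"
    and "n \<ge> 1"
  shows "distributed M (\<Pi>\<^sub>M i\<in>{1..n}. lborel)
           (\<lambda>\<omega>. \<lambda>i\<in>{1..n}. nearest_dist (\<Phi> \<omega>) i)
           (\<lambda>x. if 0 < x 1 \<and> strict_mono_on {1..n} x
                then ennreal ((2 * lambda_D) ^ n * exp (- 2 * lambda_D * x n)) else 0)"
proof -
  interpret homogeneous_poisson_process M lambda_D \<Phi> by fact
  show ?thesis
    unfolding distributed_def nearest_density_def[symmetric]
    using distr_nearest_dists[OF assms(2,3)] nearest_density_measurable[OF assms(3)]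
      nearest_dists_measurable by blast
qed

end
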